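(* Let $n\ge 2$ and let $\Lambda$ be an $(n-1)$-dimensional lattice with Gram matrix $A$ (with respect to some basis of $\Lambda$, $A$ being an $(n-1)\times(n-1)$ positive-definite real symmetric matrix). Then for every $\epsilon>0$ there exist a nonzero vector $v\in\mathbb{Z}^n$, a basis $B$ of the $(n-1)$-dimensional lattice $\Lambda_v^{*}$, and a real number $c$ such that, if $A_v^{*}$ denotes the Gram matrix of $B$, then $\|A-cA_v^{*}\|_\infty<\epsilon$.
   Context: For a nonzero $v\in\mathbb{Z}^n$, let $v^\perp=\{x\in\mathbb{R}^n : x\cdot v=0\}$ and let $\Lambda_v$ denote the orthogonal projection of $\mathbb{Z}^n$ onto $v^\perp$, an $(n-1)$-dimensional lattice in $v^\perp$. $\Lambda_v^{*}$ denotes its dual lattice within $v^\perp$, which equals $\mathbb{Z}^n\cap v^\perp$. The Gram matrix of a basis $b_1,\dots,b_{n-1}$ is $(b_i\cdot b_j)_{i,j}$, and $\|M\|_\infty=\max_{i,j}|M_{i,j}|$. *)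

theory Defs
  imports "HOL-Analysis.Analysis"
begin

definition int_lattice :: "(real ^ 'n) set" where
  "int_lattice = {x. \<forall>i. x $ i \<in> \<int>}"

definition perp :: "real ^ 'n \<Rightarrow> (real ^ 'n) set" where
  "perp v = {x. x \<bullet> v = 0}"

definition proj_perp :: "real ^ 'n \<Rightarrow> real ^ 'n \<Rightarrow> real ^ 'n" where
  "proj_perp v x = x - ((x \<bullet> v) / (v \<bullet> v)) *\<^sub>R v"

definition proj_lattice :: "real ^ 'n \<Rightarrow> (real ^ 'n) set" where
  "proj_lattice v = proj_perp v ` int_lattice"

definition dual_lattice :: "'a::real_inner set \<Rightarrow> 'a set \<Rightarrow> 'a set" where
  "dual_lattice V L = {y \<in> V. \<forall>x\<in>L. x \<bullet> y \<in> \<int>}"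

text \<open>A basis is a family, since the order of its members matters for the Gram matrix. As \<open>b\<close> is
  injective with independent range, a set with such a basis is a lattice of dimension \<open>CARD('m)\<close>.\<close>

definition is_lattice_basis :: "('m::finite \<Rightarrow> 'a::real_vector) \<Rightarrow> 'a set \<Rightarrow> bool" where
  "is_lattice_basis b L \<longleftrightarrow> inj b \<and> independent (range b) \<and>
     L = range (\<lambda>k :: 'm \<Rightarrow> int. \<Sum>i\<in>UNIV. of_int (k i) *\<^sub>R b i)"

definition gram :: "('m \<Rightarrow> 'a::real_inner) \<Rightarrow> real ^ 'm ^ 'm" where
  "gram b = (\<chi> i j. b i \<bullet> b j)"

definition max_norm :: "real ^ 'm ^ 'k \<Rightarrow> real" where
  "max_norm M = Max {\<bar>M $ i $ j\<bar> | i j. True}"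

lemma proj_perp_in_perp: "proj_perp v x \<in> perp v"
  by (cases "v = 0") (auto simp: proj_perp_def perp_def inner_diff_left)

lemma proj_perp_orthogonal: "y \<in> perp v \<Longrightarrow> (x - proj_perp v x) \<bullet> y = 0"
  by (auto simp: proj_perp_def perp_def inner_commute)

lemma dual_proj_lattice:
  fixes v :: "real ^ 'n"
  shows "dual_lattice (perp v) (proj_lattice v) = int_lattice \<inter> perp v"
proof -
  have *: "proj_perp v x \<bullet> y = x \<bullet> y" if "y \<in> perp v" for x y
    using proj_perp_orthogonal[OF that, of x] by (simp add: inner_diff_left)
  have **: "(\<forall>x\<in>int_lattice. x \<bullet> y \<in> \<int>) \<longleftrightarrow> y \<in> int_lattice" for y :: "real ^ 'n"
  proof
    assume a: "\<forall>x\<in>int_lattice. x \<bullet> y \<in> \<int>"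
    have "y $ i \<in> \<int>" for i
    proof -
      have "axis i 1 \<in> (int_lattice :: (real ^ 'n) set)"
        by (auto simp: int_lattice_def axis_def)
      then have "axis i 1 \<bullet> y \<in> \<int>" using a by blast
      then show ?thesis by (simp add: inner_axis')
    qed
    then show "y \<in> int_lattice" by (simp add: int_lattice_def)
  next
    assume "y \<in> int_lattice"
    then show "\<forall>x\<in>int_lattice. x \<bullet> y \<in> \<int>"
      by (auto simp: int_lattice_def inner_vec_def intro!: Ints_sum Ints_mult)
  qed
  show ?thesis
  proof (intro set_eqI iffI)
    fix y assume "y \<in> dual_lattice (perp v) (proj_lattice v)"
    then show "y \<in> int_lattice \<inter> perp v"
      using **[of y] * by (auto simp: dual_lattice_def proj_lattice_def)
  next
    fix y assume "y \<in> int_lattice \<inter> perp v"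
    then show "y \<in> dual_lattice (perp v) (proj_lattice v)"
      using **[of y] * by (auto simp: dual_lattice_def proj_lattice_def)
  qed
qed

lemma transpose_gram: "transpose (gram b) = gram b"
  by (simp add: gram_def transpose_def inner_commute)

lemma gram_positive_definite:
  fixes b :: "'m::finite \<Rightarrow> 'a::real_inner"
  assumes "is_lattice_basis b L" and "x \<noteq> 0"
  shows "x \<bullet> (gram b *v x) > 0"
proof -
  define s where "s = (\<Sum>i\<in>UNIV. x $ i *\<^sub>R b i)"
  have b: "inj b" "independent (range b)"
    using assms(1) by (auto simp: is_lattice_basis_def)
  have "x \<bullet> (gram b *v x) = s \<bullet> s"
    unfolding s_def gram_def inner_vec_def matrix_vector_mult_def inner_sum_left inner_sum_right
    by (simp add: sum_distrib_left inner_commute mult_ac)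
  moreover have "s \<noteq> 0"
  proof
    assume "s = 0"
    then have "(\<Sum>w\<in>range b. x $ (inv b w) *\<^sub>R w) = 0"
      using b(1) by (simp add: s_def sum.reindex)
    then have "\<forall>w\<in>range b. x $ (inv b w) = 0"
      using independentD[OF b(2), of "range b" "\<lambda>w. x $ (inv b w)"] by auto
    then have "x $ i = 0" for i
      using b(1) by (metis inv_f_f rangeI)
    then show False using assms(2) by (simp add: vec_eq_iff)
  qed
  ultimately show ?thesis by simp
qed

end

theory Submission
  imports Defs
begin

text \<open>Gram--Schmidt gives a lower triangular \<open>L\<close> with \<open>L L\<^sup>T = A\<close>. Scale \<open>L\<close> by a large \<open>N\<close>,
  round down, and put a \<open>1\<close> to the right of each diagonal entry. Deleting the first column of the
  resulting \<open>(n-1) \<times> n\<close> integer matrix leaves a unitriangular matrix, so its rows are a basis of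
  \<open>\<int>\<^sup>n \<inter> v\<^sup>\<perp>\<close>, where \<open>v\<close> is the integer normal vector of the rows with first coordinate \<open>1\<close>. Rounding
  and the additional ones change the Gram matrix by \<open>O(N)\<close> only, while it grows like \<open>N\<^sup>2 A\<close>.\<close>

section \<open>Gram--Schmidt orthonormalisation\<close>

text \<open>A vector depending on its predecessors yields \<open>sgn 0 = 0\<close>.\<close>

fun gram_schmidt :: "(nat \<Rightarrow> 'a::real_inner) \<Rightarrow> nat \<Rightarrow> 'a" where
  "gram_schmidt b n =
     sgn (b n - (\<Sum>j<n. (b n \<bullet> gram_schmidt b j) *\<^sub>R gram_schmidt b j))"

declare gram_schmidt.simps [simp del]

text \<open>Each \<open>gram_schmidt b j\<close> is a unit vector or \<open>0\<close>, and in the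
  second case both sides vanish. This allows dependent families throughout.\<close>

lemma inner_gram_schmidt_self:
  "(x \<bullet> gram_schmidt b j) * (gram_schmidt b j \<bullet> gram_schmidt b j) = x \<bullet> gram_schmidt b j"
proof (cases "gram_schmidt b j = 0")
  case False
  then have "norm (gram_schmidt b j) = 1"
    by (subst gram_schmidt.simps, subst (asm) gram_schmidt.simps)
      (auto simp: norm_sgn sgn_zero_iff)
  then show ?thesis
    by (simp add: dot_square_norm)
qed simp

lemma gram_schmidt_orthogonal_less:
  "i < n \<Longrightarrow> gram_schmidt b n \<bullet> gram_schmidt b i = 0"
proof (induction n arbitrary: i rule: less_induct)
  case (less n)
  let ?e = "gram_schmidt b"
  \<comment> \<open>The induction hypothesis is applied at the larger of \<open>i\<close> and
    \<open>j\<close>; hence only the term \<open>j = i\<close> of the projection sum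
    survives.\<close>
  have orth: "?e j \<bullet> ?e i = 0" if "j < n" "j \<noteq> i" for j
    using less.IH[of j i] less.IH[of i j] less.prems that
    by (cases "j < i") (auto simp: inner_commute)
  have "(\<Sum>j<n. (b n \<bullet> ?e j) * (?e j \<bullet> ?e i)) = (\<Sum>j\<in>{i}. (b n \<bullet> ?e j) * (?e j \<bullet> ?e i))"
    using less.prems orth by (intro sum.mono_neutral_right) auto
  then have "(b n - (\<Sum>j<n. (b n \<bullet> ?e j) *\<^sub>R ?e j)) \<bullet> ?e i = 0"
    by (simp add: inner_diff_left inner_sum_left inner_gram_schmidt_self)
  then show ?case
    by (subst (1) gram_schmidt.simps) (simp add: sgn_div_norm)
qed

lemma gram_schmidt_orthogonal:
  "i \<noteq> j \<Longrightarrow> gram_schmidt b i \<bullet> gram_schmidt b j = 0"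
  using gram_schmidt_orthogonal_less[of i j b] gram_schmidt_orthogonal_less[of j i b]
  by (cases "i < j") (auto simp: inner_commute)

text \<open>The residual \<open>r\<close> equals \<open>norm r *\<^sub>R sgn r\<close>, even for
  \<open>r = 0\<close>, and \<open>norm r\<close> is the coefficient of \<open>b n\<close> along
  \<open>gram_schmidt b n\<close>.\<close>

lemma gram_schmidt_expansion:
  "b n = (\<Sum>j\<le>n. (b n \<bullet> gram_schmidt b j) *\<^sub>R gram_schmidt b j)"
proof -
  let ?e = "gram_schmidt b"
  define r where "r = b n - (\<Sum>j<n. (b n \<bullet> ?e j) *\<^sub>R ?e j)"
  have e: "?e n = sgn r"
    by (subst gram_schmidt.simps) (simp add: r_def)
  have "b n \<bullet> ?e n = r \<bullet> ?e n"
    by (simp add: r_def inner_diff_left inner_sum_left gram_schmidt_orthogonal)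
  also have "\<dots> = norm r"
    by (simp add: e sgn_div_norm dot_square_norm power2_eq_square divide_simps)
  finally have "(b n \<bullet> ?e n) *\<^sub>R ?e n = r"
    by (cases "r = 0") (simp_all add: e sgn_div_norm)
  then show ?thesis
    by (simp add: r_def flip: lessThan_Suc_atMost)
qed

text \<open>This is the triangularity of the factor \<open>L\<close> with entries
  \<open>b p \<bullet> gram_schmidt b q\<close>.\<close>

lemma inner_gram_schmidt_eq_0:
  assumes "n < j" shows "b n \<bullet> gram_schmidt b j = 0"
  using assms
  by (subst gram_schmidt_expansion) (simp add: inner_sum_left gram_schmidt_orthogonal)

text \<open>With \<open>x = b p'\<close> this is an entry of \<open>A = L L^T\<close>. By
  triangularity the sum may run up to any \<open>m \<ge> p\<close>.\<close>

lemma inner_eq_sum_gram_schmidt: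
  assumes "p \<le> m"
  shows "b p \<bullet> x = (\<Sum>q\<le>m. (b p \<bullet> gram_schmidt b q) * (x \<bullet> gram_schmidt b q))"
proof -
  have "b p \<bullet> x = (\<Sum>q\<le>p. (b p \<bullet> gram_schmidt b q) * (x \<bullet> gram_schmidt b q))"
    by (subst gram_schmidt_expansion[of b p])
      (simp only: inner_sum_left inner_scaleR_left inner_commute[of x])
  also have "\<dots> = (\<Sum>q\<le>m. (b p \<bullet> gram_schmidt b q) * (x \<bullet> gram_schmidt b q))"
    using assms by (intro sum.mono_neutral_left) (auto simp: inner_gram_schmidt_eq_0)
  finally show ?thesis .
qed

section \<open>Lower triangular integer matrices bordered by ones\<close>

text \<open>The matrix is infinite, so that the blocks of rows below \<open>m\<close> and columns up
  to \<open>m\<close> are nested and induction on \<open>m\<close> applies.\<close>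

definition bordered :: "(nat \<Rightarrow> nat \<Rightarrow> int) \<Rightarrow> nat \<Rightarrow> nat \<Rightarrow> int" where
  "bordered R p q = (if q \<le> p then R p q else if q = Suc p then 1 else 0)"

text \<open>Orthogonality to row \<open>p\<close> is solved for coordinate \<open>Suc p\<close>,
  whose coefficient is \<open>1\<close>, so the solution stays integral.\<close>

fun bordered_normal :: "(nat \<Rightarrow> nat \<Rightarrow> int) \<Rightarrow> nat \<Rightarrow> int" where
  "bordered_normal R 0 = 1"
| "bordered_normal R (Suc p) = - (\<Sum>q\<le>p. R p q * bordered_normal R q)"

lemma bordered_orthogonal:
  assumes "p < m"
  shows "(\<Sum>q\<le>m. bordered R p q * bordered_normal R q) = 0"
proof -
  have "(\<Sum>q\<le>m. bordered R p q * bordered_normal R q)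
      = (\<Sum>q\<le>Suc p. bordered R p q * bordered_normal R q)"
    using assms by (intro sum.mono_neutral_right) (auto simp: bordered_def)
  also have "\<dots> = (\<Sum>q\<le>p. R p q * bordered_normal R q) + bordered_normal R (Suc p)"
    by (simp add: bordered_def)
  finally show ?thesis by simp
qed

text \<open>The coefficient of the last row is read off the last coordinate; subtracting that row
  leaves a shorter vector.\<close>

lemma bordered_rows_span:
  fixes x :: "nat \<Rightarrow> real"
  assumes "(\<Sum>q\<le>m. x q * of_int (bordered_normal R q)) = 0"
  shows "\<exists>k. (\<forall>q\<le>m. x q = (\<Sum>p<m. k p * of_int (bordered R p q)))
           \<and> ((\<forall>q. x q \<in> \<int>) \<longrightarrow> (\<forall>p. k p \<in> \<int>))"
  using assms
proof (induction m arbitrary: x)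
  case 0
  then show ?case by (intro exI[of _ "\<lambda>_. 0"]) simp
next
  case (Suc m)
  define y where "y q = x q - x (Suc m) * of_int (bordered R m q)" for q
  have "(\<Sum>q\<le>Suc m. of_int (bordered R m q) * of_int (bordered_normal R q)) = (0 :: real)"
    using arg_cong[OF bordered_orthogonal[of m "Suc m" R], of "of_int :: int \<Rightarrow> real"]
    by simp
  then have "(\<Sum>q\<le>Suc m. y q * of_int (bordered_normal R q)) = 0"
    using Suc.prems
    by (simp add: y_def left_diff_distrib sum_subtractf mult.assoc flip: sum_distrib_left
        del: sum.atMost_Suc bordered_normal.simps)
  \<comment> \<open>The top term drops out: row \<open>m\<close> has a \<open>1\<close> in column
    \<open>Suc m\<close>, so \<open>y (Suc m) = 0\<close>.\<close>
  then have "(\<Sum>q\<le>m. y q * of_int (bordered_normal R q)) = 0"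
    by (simp add: y_def bordered_def del: bordered_normal.simps)
  from Suc.IH[OF this] obtain k where
    k: "\<And>q. q \<le> m \<Longrightarrow> y q = (\<Sum>p<m. k p * of_int (bordered R p q))"
    and int: "(\<forall>q. y q \<in> \<int>) \<longrightarrow> (\<forall>p. k p \<in> \<int>)" by blast
  define l where "l = k(m := x (Suc m))"
  have "x q = (\<Sum>p<Suc m. l p * of_int (bordered R p q))" if "q \<le> Suc m" for q
  proof (cases "q = Suc m")
    case True
    then show ?thesis by (simp add: l_def bordered_def)
  next
    case False
    then have "x q = (\<Sum>p<m. k p * of_int (bordered R p q)) + x (Suc m) * of_int (bordered R m q)"
      using k[of q] that by (simp add: y_def)
    then show ?thesis by (simp add: l_def)
  qed
  moreover have "l p \<in> \<int>" if "\<forall>q. x q \<in> \<int>" for p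
    using int that by (auto simp: l_def y_def)
  ultimately show ?case by blast
qed

text \<open>\<open>f\<close> and \<open>g\<close> number the rows and columns. Real coefficients
  from \<open>bordered_rows_span\<close> show that the rows span the hyperplane; their integrality
  at integer points gives the lattice.\<close>

lemma bordered_lattice_basis:
  fixes f :: "'m::finite \<Rightarrow> nat" and g :: "'n::finite \<Rightarrow> nat" and R :: "nat \<Rightarrow> nat \<Rightarrow> int"
  assumes f: "bij_betw f UNIV {..<m}" and g: "bij_betw g UNIV {..m}"
  defines "B \<equiv> \<lambda>i. (\<chi> c. of_int (bordered R (f i) (g c))) :: real ^ 'n"
    and "v \<equiv> (\<chi> c. of_int (bordered_normal R (g c))) :: real ^ 'n"
  shows "v \<in> int_lattice" "v \<noteq> 0" "is_lattice_basis B (int_lattice \<inter> perp v)"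
proof -
  have inner: "x \<bullet> y = (\<Sum>q\<le>m. x $ inv g q * y $ inv g q)" for x y :: "real ^ 'n"
    unfolding inner_vec_def
    using g by (subst sum.reindex_bij_betw[OF g, symmetric]) (simp add: bij_betw_def)
  have gi: "g (inv g q) = q" if "q \<le> m" for q
    using g that by (auto simp: bij_betw_def intro: f_inv_into_f)
  have gm: "g c \<le> m" for c
    using g by (auto simp: bij_betw_def)
  have sumf: "(\<Sum>p<m. h p) = (\<Sum>i\<in>UNIV. h (f i))" for h :: "nat \<Rightarrow> real"
    by (rule sum.reindex_bij_betw[OF f, symmetric])
  show v_int: "v \<in> int_lattice"
    by (simp add: v_def int_lattice_def)
  have "v $ inv g 0 = 1"
    by (simp add: v_def gi)
  then show v_nz: "v \<noteq> 0" by auto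
  have perpB: "B i \<in> perp v" for i
  proof -
    have "f i < m" using f by (auto simp: bij_betw_def)
    have "B i \<bullet> v = of_int (\<Sum>q\<le>m. bordered R (f i) q * bordered_normal R q)"
      by (simp add: inner B_def v_def gi)
    then show ?thesis
      using bordered_orthogonal[OF \<open>f i < m\<close>, of R] by (simp add: perp_def)
  qed
  have decomp: "\<exists>k. x = (\<Sum>i\<in>UNIV. k i *\<^sub>R B i) \<and> (x \<in> int_lattice \<longrightarrow> (\<forall>i. k i \<in> \<int>))"
    if "x \<in> perp v" for x
  proof -
    have "(\<Sum>q\<le>m. x $ inv g q * of_int (bordered_normal R q)) = 0"
      using that by (simp add: perp_def inner v_def gi)
    from bordered_rows_span[OF this] obtain k where
      k: "\<And>q. q \<le> m \<Longrightarrow> x $ inv g q = (\<Sum>p<m. k p * of_int (bordered R p q))"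
      and int: "(\<forall>q. x $ inv g q \<in> \<int>) \<longrightarrow> (\<forall>p. k p \<in> \<int>)" by blast
    have "x $ c = (\<Sum>i\<in>UNIV. k (f i) *\<^sub>R B i) $ c" for c
      using k[OF gm, of c] g by (simp add: sumf B_def bij_betw_def)
    then have "x = (\<Sum>i\<in>UNIV. k (f i) *\<^sub>R B i)"
      by (simp add: vec_eq_iff)
    with int show ?thesis
      by (intro exI[of _ "k \<circ> f"]) (auto simp: int_lattice_def)
  qed
  have card: "CARD('m) = m" "CARD('n) = Suc m"
    using bij_betw_same_card[OF f] bij_betw_same_card[OF g] by auto
  have dim: "dim (perp v) = m"
    using dim_hyperplane[OF v_nz] card by (simp add: perp_def inner_commute)
  have span: "perp v \<subseteq> span (range B)"
    using decomp by (fastforce intro: span_sum span_scale span_base)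
  \<comment> \<open>At most \<open>m\<close> rows span a space of dimension \<open>m\<close>;
    counting then yields both injectivity and independence.\<close>
  have "dim (perp v) \<le> card (range B)"
    using span perpB by (intro span_card_ge_dim) auto
  moreover have "card (range B) \<le> m"
    using card_image_le[of UNIV B] card by simp
  ultimately have cardB: "card (range B) = m" using dim by simp
  have "inj B"
    using cardB card by (intro eq_card_imp_inj_on) auto
  moreover have "independent (range B)"
  proof (rule card_le_dim_spanning[OF _ span])
    show "range B \<subseteq> perp v" using perpB by blast
  qed (simp_all add: dim cardB)
  moreover have "int_lattice \<inter> perp v = range (\<lambda>k :: 'm \<Rightarrow> int. \<Sum>i\<in>UNIV. of_int (k i) *\<^sub>R B i)"
  proof (intro set_eqI iffI)
    fix x assume x: "x \<in> int_lattice \<inter> perp v"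
    then obtain k where k: "x = (\<Sum>i\<in>UNIV. k i *\<^sub>R B i)" "\<And>i. k i \<in> \<int>"
      using decomp by blast
    then have "x = (\<Sum>i\<in>UNIV. of_int \<lfloor>k i\<rfloor> *\<^sub>R B i)" by simp
    then show "x \<in> range (\<lambda>k :: 'm \<Rightarrow> int. \<Sum>i\<in>UNIV. of_int (k i) *\<^sub>R B i)"
      by (rule range_eqI[where x = "\<lambda>i. \<lfloor>k i\<rfloor>"])
  next
    fix x assume "x \<in> range (\<lambda>k :: 'm \<Rightarrow> int. \<Sum>i\<in>UNIV. of_int (k i) *\<^sub>R B i)"
    then obtain k :: "'m \<Rightarrow> int" where k: "x = (\<Sum>i\<in>UNIV. of_int (k i) *\<^sub>R B i)" by blast
    have "x \<in> perp v"
      using perpB by (simp add: k perp_def inner_sum_left)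
    moreover have "x \<in> int_lattice"
      by (auto simp: k int_lattice_def B_def)
    ultimately show "x \<in> int_lattice \<inter> perp v" by blast
  qed
  ultimately show "is_lattice_basis B (int_lattice \<inter> perp v)"
    by (simp add: is_lattice_basis_def)
qed

section \<open>Approximation\<close>

lemma tendsto_floor_scaled:
  fixes x :: real
  shows "(\<lambda>N. of_int \<lfloor>real N * x\<rfloor> / real N) \<longlonglongrightarrow> x"
proof (rule Lim_null_comparison[THEN LIM_zero_cancel])
  show "\<forall>\<^sub>F N in sequentially. norm (of_int \<lfloor>real N * x\<rfloor> / real N - x) \<le> 1 / real N"
    using eventually_gt_at_top[of 0]
  proof eventually_elim
    case (elim N)
    have "\<bar>of_int \<lfloor>real N * x\<rfloor> - real N * x\<bar> \<le> 1"
      by linarith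
    moreover have "of_int \<lfloor>real N * x\<rfloor> / real N - x = (of_int \<lfloor>real N * x\<rfloor> - real N * x) / real N"
      using elim by (simp add: field_simps)
    ultimately show ?case
      using elim by (simp add: abs_divide divide_right_mono)
  qed
qed (rule lim_1_over_n)

lemma max_norm_less_iff:
  fixes M :: "real ^ 'm::finite ^ 'k::finite"
  shows "max_norm M < e \<longleftrightarrow> (\<forall>i j. \<bar>M $ i $ j\<bar> < e)"
proof -
  have "{\<bar>M $ i $ j\<bar> | i j. True} = (\<lambda>(i, j). \<bar>M $ i $ j\<bar>) ` UNIV"
    by auto
  then show ?thesis
    unfolding max_norm_def by (subst Max_less_iff) auto
qed

text \<open>After division by \<open>N\<close>, the bordered matrix converges entrywise to
  \<open>L\<close>: rounding errors and the extra ones are at most \<open>1 / N\<close>. The Gram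
  entries then converge to those of \<open>L L^T\<close>.\<close>

lemma bordered_gram_tendsto:
  fixes b :: "nat \<Rightarrow> 'a::real_inner"
  defines "R \<equiv> \<lambda>N p q. \<lfloor>real N * (b p \<bullet> gram_schmidt b q)\<rfloor>"
  assumes "p \<le> m"
  shows "(\<lambda>N. (\<Sum>q\<le>m. of_int (bordered (R N) p q) * of_int (bordered (R N) p' q)) / (real N)\<^sup>2)
           \<longlonglongrightarrow> b p \<bullet> b p'"
proof -
  have "(\<lambda>N. of_int (bordered (R N) p q) / real N) \<longlonglongrightarrow> b p \<bullet> gram_schmidt b q" for p q
    using tendsto_floor_scaled[of "b p \<bullet> gram_schmidt b q"] lim_1_over_n[where 'a = real]
    by (cases "q \<le> p"; cases "q = Suc p") (auto simp: bordered_def R_def inner_gram_schmidt_eq_0)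
  then have "(\<lambda>N. \<Sum>q\<le>m. (of_int (bordered (R N) p q) / real N) * (of_int (bordered (R N) p' q) / real N))
           \<longlonglongrightarrow> (\<Sum>q\<le>m. (b p \<bullet> gram_schmidt b q) * (b p' \<bullet> gram_schmidt b q))"
    by (intro tendsto_sum tendsto_mult)
  then show ?thesis
    using inner_eq_sum_gram_schmidt[OF \<open>p \<le> m\<close>, of b "b p'"]
    by (simp add: sum_divide_distrib power2_eq_square)
qed

theorem theorem2:
  fixes \<Lambda> :: "'a::euclidean_space set"
    and b :: "'m::finite \<Rightarrow> 'a"
    and A :: "real ^ 'm ^ 'm"
    and \<epsilon> :: real
  assumes n: "CARD('n::finite) \<ge> 2"
    and m: "CARD('m) = CARD('n) - 1"
    and basis: "is_lattice_basis b \<Lambda>"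
    and A: "A = gram b"
    and eps: "\<epsilon> > 0"
  shows "\<exists>(v :: real ^ 'n) (B :: 'm \<Rightarrow> real ^ 'n) (c :: real).
           v \<in> int_lattice \<and> v \<noteq> 0 \<and>
           is_lattice_basis B (dual_lattice (perp v) (proj_lattice v)) \<and>
           max_norm (A - c *\<^sub>R gram B) < \<epsilon>"
proof -
  define m where "m = CARD('m)"
  obtain f :: "'m \<Rightarrow> nat" where f: "bij_betw f UNIV {..<m}"
    using ex_bij_betw_finite_nat[of "UNIV :: 'm set"] by (auto simp: m_def atLeast0LessThan)
  have "CARD('n) = Suc m"
    using n m by (simp add: m_def)
  then obtain g :: "'n \<Rightarrow> nat" where g: "bij_betw g UNIV {..m}"
    using ex_bij_betw_finite_nat[of "UNIV :: 'n set"]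
    by (auto simp: atLeast0LessThan lessThan_Suc_atMost)
  \<comment> \<open>From index \<open>m\<close> on, \<open>b'\<close> repeats some basis vector, a
    dependence that the Gram--Schmidt lemmas permit.\<close>
  define b' where "b' = b \<circ> inv f"
  have b': "b' (f i) = b i" for i
    using f by (simp add: b'_def bij_betw_def)
  define R where "R N p q = \<lfloor>real N * (b' p \<bullet> gram_schmidt b' q)\<rfloor>" for N p q
  define B where "B N i = ((\<chi> c. of_int (bordered (R N) (f i) (g c))) :: real ^ 'n)" for N i
  have gram: "gram (B N) $ i $ j
      = (\<Sum>q\<le>m. of_int (bordered (R N) (f i) q) * of_int (bordered (R N) (f j) q))" for N i j
    by (subst sum.reindex_bij_betw[OF g, symmetric]) (simp add: gram_def B_def inner_vec_def)
  have lim: "(\<lambda>N. gram (B N) $ i $ j / (real N)\<^sup>2) \<longlonglongrightarrow> A $ i $ j" for i j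
  proof -
    have "f i \<le> m" using f by (auto simp: bij_betw_def intro: less_imp_le)
    from bordered_gram_tendsto[OF this, of b' "f j"] show ?thesis
      unfolding gram by (simp add: R_def[abs_def] A b' gram_def[of b])
  qed
  \<comment> \<open>There are finitely many entries, so one \<open>N\<close> serves them all; the
    scaling constant is then \<open>c = 1 / (real N)\<^sup>2\<close>.\<close>
  have "\<forall>\<^sub>F N in sequentially. \<forall>i j. \<bar>gram (B N) $ i $ j / (real N)\<^sup>2 - A $ i $ j\<bar> < \<epsilon>"
    using tendstoD[OF lim eps] by (intro eventually_all_finite) (simp add: dist_real_def)
  then obtain N where N: "\<And>i j. \<bar>gram (B N) $ i $ j / (real N)\<^sup>2 - A $ i $ j\<bar> < \<epsilon>"
    using eventually_happens trivial_limit_sequentially by blast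
  have "max_norm (A - (1 / (real N)\<^sup>2) *\<^sub>R gram (B N)) < \<epsilon>"
    unfolding max_norm_less_iff using N by (simp add: abs_minus_commute)
  moreover note bordered_lattice_basis[OF f g, of "R N"]
  ultimately show ?thesis
    unfolding dual_proj_lattice B_def[abs_def] by blast
qed

end
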